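(* Let $\mathbb{T}$ be a time scale, $a,b\in\mathbb{T}$ with $a<b$, and $\mathbb{T}_\ast:=[a,b]_{\mathbb{T}}$. Let $u:\mathbb{T}_\ast\to\mathbb{R}$ and $f:\mathbb{T}_\ast^{\kappa}\to\mathbb{R}$ be nonnegative rd-continuous functions. Let $k:\mathbb{T}_\ast\times\mathbb{T}_\ast^{\kappa}\to\mathbb{R}$ be an admissible kernel (as defined in the context) such that $k(t,s)$ and $k^{\Delta_1}(t,s)$ are nonnegative for every $t,s\in\mathbb{T}_\ast$ with $s\leq t$ for which they are defined, and assume that $k$ is not identically zero on $\mathbb{T}_\ast^{\kappa}\times\mathbb{T}_\ast^{\kappa^2}$. Let $\Phi\in C(\mathbb{R}^+_0,\mathbb{R}^+_0)$ be a nondecreasing, subadditive and submultiplicative function such that $\Phi(x)>0$ for $x>0$, and let $W\in C(\mathbb{R}^+_0,\mathbb{R}^+_0)$ be a nondecreasing function such that $W(x)>0$ for $x>0$. Let $g$ belong to the class $S$, and let $a(\cdot):\mathbb{T}_\ast\to(0,\infty)$ be a positive, rd-continuous and nondecreasing function. Suppose that for all $t\in\mathbb{T}_\ast$ $$u(t)\leq a(t)+\int_a^t f(s)g(u(s))\Delta s+\int_a^t f(s)W\left(\int_a^s k(s,\tau)\Phi(u(\tau))\Delta\tau\right)\Delta s.$$ Define $$\Psi(x)=\int_{x_0}^x\frac{1}{\Phi(W(s))}\,ds,\quad x>0,\ x_0>0,\qquad G(x)=\int_\delta^x\frac{ds}{g(s)},\quad x>0,\ \delta>0,$$ $$q(t)=G^{-1}\left(G(1)+\int_a^t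 f(\tau)\Delta\tau\right),\qquad \bar\zeta=\int_a^{\rho(b)}k(\rho(b),s)\Phi\left(q(s)\max\{a(s),1\}\right)\Delta s,$$ where $\Psi^{-1}$ and $G^{-1}$ denote the inverse functions of $\Psi$ and $G$. Then for all $t\in\mathbb{T}_\ast$ satisfying $$G(1)+\int_a^t f(\tau)\Delta\tau\in \mathrm{Dom}(G^{-1})$$ and $$\Psi(\bar\zeta)+\int_a^{\rho(t)}k(\rho(t),\tau)\Phi(q(\tau))\Phi\left(\int_a^\tau f(\theta)\Delta\theta\right)\Delta\tau\in \mathrm{Dom}(\Psi^{-1}),$$ we have $$u(t)\leq q(t)\max\{a(t),1\}+q(t)\int_a^t f(s)W\left[\Psi^{-1}\left(\Psi(\bar\zeta)+\int_a^s k(s,\tau)\Phi(q(\tau))\Phi\left(\int_a^\tau f(\theta)\Delta\theta\right)\Delta\tau\right)\right]\Delta s.$$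
   Context: A time scale $\mathbb{T}$ is a nonempty closed subset of $\mathbb{R}$. $\mathbb{R}^+_0=[0,\infty)$. For $a<b$ in $\mathbb{T}$, $[a,b]_{\mathbb{T}}=\{t\in\mathbb{T}:a\leq t\leq b\}$, and $\mathbb{T}_\ast=[a,b]_{\mathbb{T}}$ is regarded as a time scale itself. On $\mathbb{T}_\ast$: $\sigma(t)=\inf\{s\in\mathbb{T}_\ast:s>t\}$ (with $\sigma(b)=b$), $\rho(t)=\sup\{s\in\mathbb{T}_\ast:s<t\}$ (with $\rho(a)=a$). $\mathbb{T}_\ast^{\kappa}=\mathbb{T}_\ast\setminus\{b\}$ if $\rho(b)<b$ and $\mathbb{T}_\ast^{\kappa}=\mathbb{T}_\ast$ otherwise; $\mathbb{T}_\ast^{\kappa^2}=(\mathbb{T}_\ast^{\kappa})^{\kappa}$. $\int\cdot\,\Delta s$ is the delta integral. A function is rd-continuous if it is continuous at right-dense points ($\sigma(t)=t$) and has finite left-sided limits at left-dense points ($\rho(t)=t$). Admissible kernel: $k:\mathbb{T}_\ast\times\mathbb{T}_\ast^{\kappa}\to\mathbb{R}$ satisfies, for each $t\in\mathbb{T}_\ast^{\kappa}$ with $t>a$: $k$ is continuous at $(t,t)$; the delta derivative $k^{\Delta_1}(t,\cdot)$ of $k$ with respect to its first variable is rd-continuous on $[a,\sigma(t)]$ (where defined); and for each $\varepsilon>0$ there is a neighborhood $U$ of $t$, independent of $\tau\in[a,\sigma(t)]$, such that $|k(\sigma(t),\tau)-k(s,\tau)-k^{\Delta_1}(t,\tau)(\sigma(t)-s)|\le\varepsilon|\sigma(t)-s|$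 for all $s\in U$. The delta integrals appearing in the statement are understood to exist. Class $S$: a nondecreasing continuous function $g:\mathbb{R}^+_0\to\mathbb{R}^+_0$ belongs to class $S$ if (1) $g(x)>0$ for $x>0$, and (2) $(1/z)g(x)\leq g(x/z)$ for all $x\geq0$ and $z\geq1$. Subadditive: $\Phi(x+y)\le\Phi(x)+\Phi(y)$; submultiplicative: $\Phi(xy)\le\Phi(x)\Phi(y)$, for all $x,y\ge0$. $\Psi$ and $G$ are defined on $(0,\infty)$ with fixed $x_0>0$, $\delta>0$; $\mathrm{Dom}(\Psi^{-1})$ and $\mathrm{Dom}(G^{-1})$ are the ranges of $\Psi$ and $G$. It is understood that $q(s)$ is defined for the $s$ entering the definition of $\bar\zeta$. The function $a(\cdot)$, always written with an argument, is distinct from the endpoint $a$. *)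

theory Defs
  imports "HOL-Analysis.Analysis"
begin

definition time_scale :: "real set \<Rightarrow> bool" where
  "time_scale T \<longleftrightarrow> closed T \<and> T \<noteq> {}"

definition fwd_jump :: "real set \<Rightarrow> real \<Rightarrow> real" where
  "fwd_jump T t = (if \<exists>s\<in>T. t < s then Inf {s \<in> T. t < s} else t)"

definition bwd_jump :: "real set \<Rightarrow> real \<Rightarrow> real" where
  "bwd_jump T t = (if \<exists>s\<in>T. s < t then Sup {s \<in> T. s < t} else t)"

(* Removes the maximum of T if there is one and it is left-scattered. *)
definition ts_kappa :: "real set \<Rightarrow> real set" where
  "ts_kappa T = T - {m \<in> T. (\<forall>s\<in>T. s \<le> m) \<and> bwd_jump T m < m}"

(* Rd-continuity of a function whose domain A is a subset of T.  Density of a point is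
   judged in T, while limits are taken within A.  At the minimum of A the left-hand limit
   is taken along the trivial filter, so nothing is required there. *)
definition rd_continuous_on :: "real set \<Rightarrow> real set \<Rightarrow> (real \<Rightarrow> real) \<Rightarrow> bool" where
  "rd_continuous_on T A f \<longleftrightarrow>
     (\<forall>t\<in>A. (fwd_jump T t = t \<longrightarrow> continuous (at t within A) f) \<and>
            (bwd_jump T t = t \<longrightarrow> (\<exists>l. (f \<longlongrightarrow> l) (at t within (A \<inter> {..<t})))))"

definition has_delta_deriv :: "real set \<Rightarrow> (real \<Rightarrow> real) \<Rightarrow> real \<Rightarrow> real \<Rightarrow> bool" where
  "has_delta_deriv T f D t \<longleftrightarrow> t \<in> ts_kappa T \<and>
     (\<forall>\<epsilon>>0. \<exists>d>0. \<forall>s\<in>T. \<bar>s - t\<bar> < d \<longrightarrow>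
        \<bar>f (fwd_jump T t) - f s - D * (fwd_jump T t - s)\<bar> \<le> \<epsilon> * \<bar>fwd_jump T t - s\<bar>)"

definition delta_deriv :: "real set \<Rightarrow> (real \<Rightarrow> real) \<Rightarrow> real \<Rightarrow> real" where
  "delta_deriv T f t = (THE D. has_delta_deriv T f D t)"

(* The integral of h from r to s (r, s in T, r \<le> s) is F s - F r for an antiderivative F of h
   on T between r and s.  At the right endpoint s only continuity of F is required: if s is
   left-dense but right-scattered in T, an rd-continuous h need not agree at s with its
   left-hand limit, so F, restricted to the points up to s, need not have delta derivative h s
   there; continuity still determines F s.  Every function that is rd-continuous on T
   is integrable in this sense. *)
definition has_delta_integral ::
    "real set \<Rightarrow> real \<Rightarrow> real \<Rightarrow> (real \<Rightarrow> real) \<Rightarrow> real \<Rightarrow> bool" where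
  "has_delta_integral T r s h I \<longleftrightarrow>
     (\<exists>F. continuous_on (T \<inter> {r..s}) F \<and>
          (\<forall>t \<in> T \<inter> {r..<s}. has_delta_deriv (T \<inter> {r..s}) F (h t) t) \<and>
          I = F s - F r)"

definition delta_integrable :: "real set \<Rightarrow> real \<Rightarrow> real \<Rightarrow> (real \<Rightarrow> real) \<Rightarrow> bool" where
  "delta_integrable T r s h \<longleftrightarrow> (\<exists>I. has_delta_integral T r s h I)"

definition delta_integral :: "real set \<Rightarrow> real \<Rightarrow> real \<Rightarrow> (real \<Rightarrow> real) \<Rightarrow> real" where
  "delta_integral T r s h = (THE I. has_delta_integral T r s h I)"

abbreviation delta_deriv1 :: "real set \<Rightarrow> (real \<Rightarrow> real \<Rightarrow> real) \<Rightarrow> real \<Rightarrow> real \<Rightarrow> real" where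
  "delta_deriv1 T k t \<tau> \<equiv> delta_deriv T (\<lambda>x. k x \<tau>) t"

(* Here a is the minimum of T.  The kernel lives on T \<times> ts_kappa T, so that
   [a, \<sigma>(t)] as a range for the second argument means ts_kappa T \<inter> {a..\<sigma>(t)}. *)
definition admissible_kernel :: "real set \<Rightarrow> real \<Rightarrow> (real \<Rightarrow> real \<Rightarrow> real) \<Rightarrow> bool" where
  "admissible_kernel T a k \<longleftrightarrow>
     (\<forall>t\<in>ts_kappa T. a < t \<longrightarrow>
        continuous (at (t, t) within (T \<times> ts_kappa T)) (\<lambda>(x, y). k x y) \<and>
        rd_continuous_on T (ts_kappa T \<inter> {a..fwd_jump T t}) (delta_deriv1 T k t) \<and>
        (\<forall>\<epsilon>>0. \<exists>d>0. \<forall>\<tau> \<in> ts_kappa T \<inter> {a..fwd_jump T t}. \<forall>s\<in>T. \<bar>s - t\<bar> < d \<longrightarrow>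
           \<bar>k (fwd_jump T t) \<tau> - k s \<tau> - delta_deriv1 T k t \<tau> * (fwd_jump T t - s)\<bar>
             \<le> \<epsilon> * \<bar>fwd_jump T t - s\<bar>))"

(* Functions on the nonnegative reals are represented by total functions whose values at
   negative arguments are irrelevant. *)
definition nondecr_cont_nonneg :: "(real \<Rightarrow> real) \<Rightarrow> bool" where
  "nondecr_cont_nonneg h \<longleftrightarrow>
     continuous_on {0..} h \<and> mono_on {0..} h \<and> (\<forall>x\<ge>0. 0 \<le> h x)"

definition class_S :: "(real \<Rightarrow> real) \<Rightarrow> bool" where
  "class_S g \<longleftrightarrow> nondecr_cont_nonneg g \<and> (\<forall>x>0. 0 < g x) \<and>
     (\<forall>x\<ge>0. \<forall>z\<ge>1. (1 / z) * g x \<le> g (x / z))"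

definition subadditive_nonneg :: "(real \<Rightarrow> real) \<Rightarrow> bool" where
  "subadditive_nonneg h \<longleftrightarrow> (\<forall>x\<ge>0. \<forall>y\<ge>0. h (x + y) \<le> h x + h y)"

definition submultiplicative_nonneg :: "(real \<Rightarrow> real) \<Rightarrow> bool" where
  "submultiplicative_nonneg h \<longleftrightarrow> (\<forall>x\<ge>0. \<forall>y\<ge>0. h (x * y) \<le> h x * h y)"

end

theory Submission
  imports Defs
begin

text \<open>Write \<open>n(t) = max {a(t), 1} + \<integral>\<^sub>a\<^sup>t f W(y)\<close> with \<open>y(s) = \<integral>\<^sub>a\<^sup>s k(s, \<cdot>) \<Phi>(u)\<close>. For fixed \<open>t\<close> divide
  the inequality by the constant \<open>N = n(t) \<ge> 1\<close>; the class \<open>S\<close> condition and Bihari's comparison applied to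
  \<open>w(s) = 1 + N\<^bsup>-1\<^esup> \<integral>\<^sub>a\<^sup>s f g(u)\<close> yield \<open>u(t) \<le> q(t) n(t)\<close>. Inserting this into \<open>\<Phi>(u)\<close> gives
  \<open>\<Phi>(u) \<le> \<Phi>(q max {a, 1}) + p \<Phi>(W(y))\<close> with \<open>p = \<Phi>(q) \<Phi>(\<integral> f)\<close>. Now fix \<open>s\<close> and freeze the kernel at its
  first argument: by monotonicity of \<open>k\<close> in that argument, \<open>Y(x) = \<integral>\<^sub>a\<^sup>x k(s, \<cdot>) \<Phi>(u)\<close> dominates \<open>y\<close> on \<open>[a, s]\<close> and
  equals it at \<open>s\<close>, and \<open>V = \<epsilon> + \<zeta> + Y - \<integral> k(\<rho>(b), \<cdot>) \<Phi>(q max {a, 1}) \<ge> \<epsilon> + Y\<close> has delta derivative at most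
  \<open>k(s, \<cdot>) p \<Phi>(W(V))\<close>. Bihari's comparison bounds \<open>\<Psi>(V(s))\<close>, and \<open>\<epsilon> \<rightarrow> 0\<close> bounds \<open>y(s)\<close>. Only integrals assumed to
  exist occur; in particular no integral involving \<open>W(y)\<close> and the kernel together is formed.\<close>

section \<open>Jump operators of a closed set\<close>

lemma closed_fwd_jump:
  assumes "closed T" "y \<in> T" "t < y"
  shows "fwd_jump T t \<in> T" "t \<le> fwd_jump T t"
    and "z \<in> T \<Longrightarrow> t < z \<Longrightarrow> fwd_jump T t \<le> z"
    and "fwd_jump T t = t \<Longrightarrow> 0 < d \<Longrightarrow> \<exists>z\<in>T. t < z \<and> z < t + d"
proof -
  let ?S = "{s \<in> T. t < s}"
  have eq: "fwd_jump T t = Inf ?S" using assms by (auto simp: fwd_jump_def)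
  have ne: "?S \<noteq> {}" using assms by auto
  have bb: "bdd_below ?S" by (rule bdd_belowI[of _ t]) auto
  have "Inf ?S \<in> closure ?S" by (rule closure_contains_Inf[OF ne bb])
  also have "closure ?S \<subseteq> T" using assms(1) by (intro closure_minimal) auto
  finally show "fwd_jump T t \<in> T" by (simp add: eq)
  show "t \<le> fwd_jump T t" unfolding eq by (rule cInf_greatest[OF ne]) auto
  show "fwd_jump T t \<le> z" if "z \<in> T" "t < z" for z
    unfolding eq using that by (intro cInf_lower bb) auto
  show "\<exists>z\<in>T. t < z \<and> z < t + d" if "fwd_jump T t = t" "0 < d"
    using cInf_lessD[OF ne, of "t + d"] that eq by auto
qed

lemma closed_bwd_jump:
  assumes "closed T" "t \<in> T"
  shows "bwd_jump T t \<in> T" "bwd_jump T t \<le> t"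
    and "s \<in> T \<Longrightarrow> s < t \<Longrightarrow> s \<le> bwd_jump T t"
proof -
  let ?S = "{s \<in> T. s < t}"
  have bb: "bdd_above ?S" by (rule bdd_aboveI[of _ t]) auto
  have eq: "bwd_jump T t = (if ?S = {} then t else Sup ?S)" by (auto simp: bwd_jump_def)
  have "Sup ?S \<in> T" if ne: "?S \<noteq> {}"
  proof -
    have "Sup ?S \<in> closure ?S" by (rule closure_contains_Sup[OF ne bb])
    also have "closure ?S \<subseteq> T" using assms(1) by (intro closure_minimal) auto
    finally show ?thesis .
  qed
  then show "bwd_jump T t \<in> T" using assms(2) by (simp add: eq)
  show "bwd_jump T t \<le> t" unfolding eq by (auto intro!: cSup_least)
  show "s \<le> bwd_jump T t" if "s \<in> T" "s < t"
    unfolding eq using that by (auto intro!: cSup_upper bb)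
qed

section \<open>Right-hand delta derivatives and primitives\<close>

text \<open>The delta derivative seen from the right only. Unlike the delta derivative it does not depend
  on the part of \<open>T\<close> beyond a later point of \<open>T\<close>, so it passes freely between \<open>T\<close> and its segments.\<close>

definition right_delta_deriv :: "real set \<Rightarrow> (real \<Rightarrow> real) \<Rightarrow> real \<Rightarrow> real \<Rightarrow> bool" where
  "right_delta_deriv T F D t \<longleftrightarrow>
     (\<forall>\<epsilon>>0. \<exists>y\<in>T. t < y \<and> (\<forall>z\<in>T. t < z \<longrightarrow> z \<le> y \<longrightarrow> \<bar>F z - F t - D * (z - t)\<bar> \<le> \<epsilon> * (z - t)))"

text \<open>The antiderivative behind \<open>has_delta_integral\<close>, with its derivative taken
  from the right in all of T. One F then yields the increments up to every intermediate
  point.\<close>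

definition delta_primitive ::
    "real set \<Rightarrow> real \<Rightarrow> real \<Rightarrow> (real \<Rightarrow> real) \<Rightarrow> (real \<Rightarrow> real) \<Rightarrow> bool" where
  "delta_primitive T r s h F \<longleftrightarrow>
     continuous_on (T \<inter> {r..s}) F \<and> (\<forall>t\<in>T \<inter> {r..<s}. right_delta_deriv T F (h t) t)"

text \<open>At a right-dense point the defining estimate is the claim on a small neighbourhood. At a
  right-scattered point \<open>fwd_jump T t\<close> is the only point to test, and the delta
  estimate at x = t settles it. The point s guarantees that a later point exists.\<close>

lemma has_delta_deriv_imp_right:
  assumes "closed T" "s \<in> T" "t \<in> T" "t < s" and "has_delta_deriv T F D t"
  shows "right_delta_deriv T F D t"
  unfolding right_delta_deriv_def
proof (intro allI impI)
  fix \<epsilon> :: real assume \<epsilon>: "0 < \<epsilon>"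
  let ?\<sigma> = "fwd_jump T t"
  note J = closed_fwd_jump[OF assms(1,2,4)]
  obtain d where d: "d > 0" and dd: "\<And>x. x \<in> T \<Longrightarrow> \<bar>x - t\<bar> < d \<Longrightarrow>
      \<bar>F ?\<sigma> - F x - D * (?\<sigma> - x)\<bar> \<le> \<epsilon> * \<bar>?\<sigma> - x\<bar>"
    using assms(5) \<epsilon> unfolding has_delta_deriv_def by blast
  show "\<exists>y\<in>T. t < y \<and> (\<forall>z\<in>T. t < z \<longrightarrow> z \<le> y \<longrightarrow> \<bar>F z - F t - D * (z - t)\<bar> \<le> \<epsilon> * (z - t))"
  proof (cases "?\<sigma> = t")
    case True
    obtain y where y: "y \<in> T" "t < y" "y < t + d" using J(4)[OF True d] by auto
    have "\<bar>F z - F t - D * (z - t)\<bar> \<le> \<epsilon> * (z - t)" if "z \<in> T" "t < z" "z \<le> y" for z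
    proof -
      have "\<bar>F t - F z - D * (t - z)\<bar> \<le> \<epsilon> * \<bar>t - z\<bar>"
        using dd[of z] that y True by auto
      moreover have "F t - F z - D * (t - z) = - (F z - F t - D * (z - t))" by (simp add: algebra_simps)
      ultimately show ?thesis using that by simp
    qed
    then show ?thesis using y by auto
  next
    case False
    then have less: "t < ?\<sigma>" using J(2) by simp
    have "\<bar>F z - F t - D * (z - t)\<bar> \<le> \<epsilon> * (z - t)" if "z \<in> T" "t < z" "z \<le> ?\<sigma>" for z
    proof -
      have "z = ?\<sigma>" using J(3)[of z] that by auto
      then show ?thesis using dd[of t] d less assms(3) by auto
    qed
    then show ?thesis using less J(1) by auto
  qed
qed

lemma right_delta_deriv_segment:
  assumes "right_delta_deriv (T \<inter> {r..s}) F D t" "r \<le> t"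
  shows "right_delta_deriv T F D t"
  unfolding right_delta_deriv_def
proof (intro allI impI)
  fix \<epsilon> :: real assume "0 < \<epsilon>"
  then obtain y where "y \<in> T \<inter> {r..s}" "t < y"
    "\<And>z. z \<in> T \<inter> {r..s} \<Longrightarrow> t < z \<Longrightarrow> z \<le> y \<Longrightarrow> \<bar>F z - F t - D * (z - t)\<bar> \<le> \<epsilon> * (z - t)"
    using assms(1) unfolding right_delta_deriv_def by blast
  then show "\<exists>y\<in>T. t < y \<and> (\<forall>z\<in>T. t < z \<longrightarrow> z \<le> y \<longrightarrow> \<bar>F z - F t - D * (z - t)\<bar> \<le> \<epsilon> * (z - t))"
    using assms(2) by (intro bexI[of _ y]) auto
qed

lemma has_delta_deriv_continuous:
  assumes t: "t \<in> T" and D: "has_delta_deriv T F D t"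
  shows "continuous (at t within T) F"
  unfolding continuous_within_eps_delta
proof (intro allI impI)
  fix e :: real assume e: "0 < e"
  let ?\<sigma> = "fwd_jump T t"
  \<comment> \<open>m is the graininess at t. Applied at x and at t, the delta estimate costs
    \<open>\<epsilon> * (m + 1)\<close> and \<open>\<epsilon> * m\<close>, together e / 2; the last
    bound in d' keeps the drift \<open>D * (x - t)\<close> below e / 2.\<close>
  define m where "m = \<bar>?\<sigma> - t\<bar>"
  define \<epsilon> where "\<epsilon> = e / (2 * (2 * m + 1))"
  have m: "0 \<le> m" by (simp add: m_def)
  have \<epsilon>: "0 < \<epsilon>" using e m by (auto simp: \<epsilon>_def)
  obtain d where d: "d > 0" and dd: "\<And>x. x \<in> T \<Longrightarrow> \<bar>x - t\<bar> < d \<Longrightarrow>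
      \<bar>F ?\<sigma> - F x - D * (?\<sigma> - x)\<bar> \<le> \<epsilon> * \<bar>?\<sigma> - x\<bar>"
    using D \<epsilon> unfolding has_delta_deriv_def by blast
  define d' where "d' = min d (min 1 (e / (2 * (\<bar>D\<bar> + 1))))"
  have "0 < d'" using d e by (auto simp: d'_def)
  moreover have "dist (F x) (F t) < e" if x: "x \<in> T" "dist x t < d'" for x
  proof -
    have xt: "\<bar>x - t\<bar> < d" "\<bar>x - t\<bar> < 1" "\<bar>x - t\<bar> < e / (2 * (\<bar>D\<bar> + 1))"
      using x by (auto simp: d'_def dist_real_def)
    have 1: "\<bar>F ?\<sigma> - F x - D * (?\<sigma> - x)\<bar> \<le> \<epsilon> * (m + 1)"
      using dd[OF x(1) xt(1)] mult_left_mono[of "\<bar>?\<sigma> - x\<bar>" "m + 1" \<epsilon>] xt(2) \<epsilon>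
      unfolding m_def by linarith
    have 2: "\<bar>F ?\<sigma> - F t - D * (?\<sigma> - t)\<bar> \<le> \<epsilon> * m" using dd[OF t] d by (auto simp: m_def)
    have 3: "\<bar>D * (x - t)\<bar> < e / 2"
    proof -
      have "\<bar>D * (x - t)\<bar> \<le> (\<bar>D\<bar> + 1) * \<bar>x - t\<bar>"
        by (simp add: abs_mult mult_right_mono)
      also have "\<dots> < e / 2" using xt(3) by (simp add: field_simps)
      finally show ?thesis .
    qed
    have eq: "F x - F t = (F ?\<sigma> - F t - D * (?\<sigma> - t)) - (F ?\<sigma> - F x - D * (?\<sigma> - x)) + D * (x - t)"
      by (simp add: algebra_simps)
    have triangle: "\<bar>A - B + C\<bar> < b + a + c" if "\<bar>A\<bar> \<le> a" "\<bar>B\<bar> \<le> b" "\<bar>C\<bar> < c" for A B C a b c :: real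
      using that by linarith
    have "\<bar>F x - F t\<bar> < \<epsilon> * (m + 1) + \<epsilon> * m + e / 2"
      unfolding eq by (rule triangle[OF 2 1 3])
    also have "\<epsilon> * (m + 1) + \<epsilon> * m = \<epsilon> * (2 * m + 1)" by (simp add: algebra_simps)
    also have "\<dots> = e / 2" using m by (simp add: \<epsilon>_def field_simps add_nonneg_eq_0_iff)
    finally show ?thesis by (simp add: dist_real_def)
  qed
  ultimately show "\<exists>d>0. \<forall>x\<in>T. dist x t < d \<longrightarrow> dist (F x) (F t) < e" by blast
qed

section \<open>Comparison along a time scale\<close>

text \<open>Continuous induction. Let c be the supremum of the points up to which
  \<open>B x - \<epsilon> * x\<close> stays at or below its value at r. Closedness and continuity
  make c one of them, the slope bound at c reaches past c unless c = s, and \<epsilon> is then sent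
  to 0.\<close>

lemma nonincreasing_if_right_slopes_le:
  fixes B :: "real \<Rightarrow> real"
  assumes T: "closed T" "r \<in> T" "s \<in> T" "r \<le> s"
    and cont: "continuous_on (T \<inter> {r..s}) B"
    and slope: "\<And>x \<epsilon>. x \<in> T \<Longrightarrow> r \<le> x \<Longrightarrow> x < s \<Longrightarrow> 0 < \<epsilon> \<Longrightarrow>
      \<exists>y\<in>T. x < y \<and> (\<forall>z\<in>T. x < z \<longrightarrow> z \<le> y \<longrightarrow> B z - B x \<le> \<epsilon> * (z - x))"
  shows "B s \<le> B r"
proof -
  have main: "B s - \<epsilon> * s \<le> B r - \<epsilon> * r" if \<epsilon>: "0 < \<epsilon>" for \<epsilon>
  proof -
    let ?K = "T \<inter> {r..s}"
    let ?C = "\<lambda>x. B x - \<epsilon> * x"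
    define S where "S = {x \<in> ?K. \<forall>z\<in>T. r \<le> z \<longrightarrow> z \<le> x \<longrightarrow> ?C z \<le> ?C r}"
    define c where "c = Sup S"
    have rS: "r \<in> S" using T by (auto simp: S_def)
    have bdd: "bdd_above S" by (rule bdd_aboveI[of _ s]) (auto simp: S_def)
    have Kcl: "closed ?K" using T by auto
    have cK: "c \<in> ?K"
    proof -
      have "c \<in> closure S" unfolding c_def using rS bdd by (intro closure_contains_Sup) auto
      also have "closure S \<subseteq> ?K" using Kcl by (intro closure_minimal) (auto simp: S_def)
      finally show ?thesis .
    qed
    have below: "?C z \<le> ?C r" if z: "z \<in> T" "r \<le> z" "z < c" for z
    proof -
      obtain x where "x \<in> S" "z < x"
        using less_cSup_iff[of S z] rS bdd z(3) unfolding c_def by auto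
      then show ?thesis using z by (auto simp: S_def)
    qed
    have contC: "continuous_on ?K ?C" using cont by (intro continuous_intros)
    have Cc: "?C c \<le> ?C r"
    proof -
      have "closed (?K \<inter> ?C -` {..?C r})"
        by (intro continuous_closed_preimage contC Kcl) auto
      moreover have "S \<subseteq> ?K \<inter> ?C -` {..?C r}" by (auto simp: S_def)
      moreover have "c \<in> closure S" unfolding c_def using rS bdd by (intro closure_contains_Sup) auto
      ultimately have "c \<in> ?K \<inter> ?C -` {..?C r}" using closure_minimal by blast
      then show ?thesis by simp
    qed
    have le: "?C z \<le> ?C r" if "z \<in> T" "r \<le> z" "z \<le> c" for z
      using below[of z] Cc that by (cases "z = c") auto
    have "c = s"
    proof (rule ccontr)
      assume "c \<noteq> s"
      then have cs: "c < s" using cK by auto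
      obtain y where y: "y \<in> T" "c < y"
        and yz: "\<And>z. z \<in> T \<Longrightarrow> c < z \<Longrightarrow> z \<le> y \<Longrightarrow> B z - B c \<le> \<epsilon> * (z - c)"
        using slope[of c \<epsilon>] cK cs \<epsilon> by auto
      \<comment> \<open>The reach is cut at s because the y supplied by the slope bound may lie
        beyond the segment.\<close>
      have "min y s \<in> S"
        unfolding S_def
      proof (intro CollectI conjI ballI impI)
        show "min y s \<in> ?K" using y T cK by (auto simp: min_def)
        fix z assume z: "z \<in> T" "r \<le> z" "z \<le> min y s"
        show "?C z \<le> ?C r"
        proof (cases "z \<le> c")
          case False
          then have "B z - B c \<le> \<epsilon> * (z - c)" using yz[of z] z by auto
          then show ?thesis using Cc by (simp add: algebra_simps)
        qed (use le z in auto)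
      qed
      then have "min y s \<le> c" unfolding c_def using bdd by (intro cSup_upper)
      then show False using y cs by auto
    qed
    then show ?thesis using Cc by simp
  qed
  show ?thesis
  proof (rule field_le_epsilon)
    fix e :: real assume e: "0 < e"
    \<comment> \<open>The summand 1 keeps the denominator positive when r = s.\<close>
    define \<epsilon> where "\<epsilon> = e / (s - r + 1)"
    have p: "0 < \<epsilon>" using e T by (auto simp: \<epsilon>_def)
    have "B s \<le> B r + \<epsilon> * (s - r)" using main[OF p] by (simp add: algebra_simps)
    also have "\<epsilon> * (s - r) \<le> \<epsilon> * (s - r + 1)" using p by (intro mult_left_mono) auto
    also have "\<epsilon> * (s - r + 1) = e" using T by (simp add: \<epsilon>_def)
    finally show "B s \<le> B r + e" by simp
  qed
qed

lemma delta_primitive_subset: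
  assumes "delta_primitive T r s h F" "r \<le> r'" "s' \<le> s"
  shows "delta_primitive T r' s' h F"
  using assms unfolding delta_primitive_def
  by (auto intro: continuous_on_subset)

lemma delta_primitive_cong:
  assumes "delta_primitive T r s h F" "\<And>t. t \<in> T \<Longrightarrow> r \<le> t \<Longrightarrow> t < s \<Longrightarrow> h t = h' t"
  shows "delta_primitive T r s h' F"
  using assms unfolding delta_primitive_def by auto

lemma delta_primitive_const:
  assumes "s \<in> T" shows "delta_primitive T r s (\<lambda>_. 0) (\<lambda>_. c)"
  \<comment> \<open>The endpoint s is the later point that \<open>right_delta_deriv\<close> asks for
    at each t < s.\<close>
  using assms unfolding delta_primitive_def right_delta_deriv_def by auto

text \<open>The shift e and the two coefficients let one rule cover scaling (c' = 0), differences
  and a prescribed initial value.\<close>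

lemma right_delta_deriv_affine:
  assumes F: "right_delta_deriv T F D t" and F': "right_delta_deriv T F' D' t"
  shows "right_delta_deriv T (\<lambda>x. e + c * F x + c' * F' x) (c * D + c' * D') t"
  unfolding right_delta_deriv_def
proof (intro allI impI)
  fix \<epsilon> :: real assume \<epsilon>: "0 < \<epsilon>"
  define \<eta> where "\<eta> = \<epsilon> / (\<bar>c\<bar> + \<bar>c'\<bar> + 1)"
  have \<eta>: "0 < \<eta>" using \<epsilon> by (auto simp: \<eta>_def)
  obtain y where y: "y \<in> T" "t < y"
    and 1: "\<And>z. z \<in> T \<Longrightarrow> t < z \<Longrightarrow> z \<le> y \<Longrightarrow> \<bar>F z - F t - D * (z - t)\<bar> \<le> \<eta> * (z - t)"
    using F \<eta> unfolding right_delta_deriv_def by blast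
  obtain y' where y': "y' \<in> T" "t < y'"
    and 2: "\<And>z. z \<in> T \<Longrightarrow> t < z \<Longrightarrow> z \<le> y' \<Longrightarrow> \<bar>F' z - F' t - D' * (z - t)\<bar> \<le> \<eta> * (z - t)"
    using F' \<eta> unfolding right_delta_deriv_def by blast
  have "\<bar>e + c * F z + c' * F' z - (e + c * F t + c' * F' t) - (c * D + c' * D') * (z - t)\<bar> \<le> \<epsilon> * (z - t)"
    if z: "z \<in> T" "t < z" "z \<le> min y y'" for z
  proof -
    have "e + c * F z + c' * F' z - (e + c * F t + c' * F' t) - (c * D + c' * D') * (z - t)
      = c * (F z - F t - D * (z - t)) + c' * (F' z - F' t - D' * (z - t))"
      by (simp add: algebra_simps)
    also have "\<bar>\<dots>\<bar> \<le> \<bar>c\<bar> * \<bar>F z - F t - D * (z - t)\<bar> + \<bar>c'\<bar> * \<bar>F' z - F' t - D' * (z - t)\<bar>"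
      unfolding abs_mult[symmetric] by (rule abs_triangle_ineq)
    also have "\<dots> \<le> \<bar>c\<bar> * (\<eta> * (z - t)) + \<bar>c'\<bar> * (\<eta> * (z - t))"
      using 1[of z] 2[of z] z by (intro add_mono mult_left_mono) auto
    also have "\<dots> \<le> (\<bar>c\<bar> + \<bar>c'\<bar> + 1) * \<eta> * (z - t)"
      using z \<eta> by (simp add: algebra_simps)
    also have "(\<bar>c\<bar> + \<bar>c'\<bar> + 1) * \<eta> = \<epsilon>" by (simp add: \<eta>_def)
    finally show ?thesis .
  qed
  then show "\<exists>y\<in>T. t < y \<and> (\<forall>z\<in>T. t < z \<longrightarrow> z \<le> y \<longrightarrow>
    \<bar>e + c * F z + c' * F' z - (e + c * F t + c' * F' t) - (c * D + c' * D') * (z - t)\<bar> \<le> \<epsilon> * (z - t))"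
    using y y' by (intro bexI[of _ "min y y'"]) (auto simp: min_def)
qed

lemma delta_primitive_affine:
  assumes "delta_primitive T r s h F" "delta_primitive T r s h' F'"
  shows "delta_primitive T r s (\<lambda>x. c * h x + c' * h' x) (\<lambda>x. e + c * F x + c' * F' x)"
  using assms unfolding delta_primitive_def
  by (auto intro!: right_delta_deriv_affine continuous_intros)

text \<open>Bihari's comparison: \<open>\<Psi>\<close> is concave with derivative \<open>1 / w\<close>, so its tangent bound controls the
  jumps of \<open>\<Psi> \<circ> V\<close> across gaps of \<open>T\<close> as well as its slopes at right-dense points.\<close>

lemma bihari_comparison:
  assumes T: "closed T" "r \<in> T" "s \<in> T" "r \<le> s"
    and V: "delta_primitive T r s D V" "\<And>x. x \<in> T \<Longrightarrow> r \<le> x \<Longrightarrow> x \<le> s \<Longrightarrow> V x \<in> A"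
    and F: "delta_primitive T r s h F"
    and le: "\<And>x. x \<in> T \<Longrightarrow> r \<le> x \<Longrightarrow> x < s \<Longrightarrow> D x \<le> h x * w (V x)"
    and w: "\<And>x. x \<in> A \<Longrightarrow> 0 < w x"
    and \<Psi>: "continuous_on A \<Psi>" "\<And>x y. x \<in> A \<Longrightarrow> y \<in> A \<Longrightarrow> \<Psi> y - \<Psi> x \<le> (y - x) / w x"
  shows "\<Psi> (V s) \<le> \<Psi> (V r) + (F s - F r)"
proof -
  have "\<Psi> (V s) - F s \<le> \<Psi> (V r) - F r"
  proof (rule nonincreasing_if_right_slopes_le[OF T])
    have "continuous_on (T \<inter> {r..s}) (\<lambda>x. \<Psi> (V x))"
      using V by (intro continuous_on_compose2[OF \<Psi>(1)]) (auto simp: delta_primitive_def)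
    then show "continuous_on (T \<inter> {r..s}) (\<lambda>x. \<Psi> (V x) - F x)"
      using F by (intro continuous_intros) (auto simp: delta_primitive_def)
    fix x \<epsilon> :: real assume x: "x \<in> T" "r \<le> x" "x < s" and \<epsilon>: "0 < \<epsilon>"
    have VA: "V x \<in> A" using V(2) x by simp
    note wx = w[OF VA]
    \<comment> \<open>The error of V is divided by \<open>w (V x)\<close> when it passes through
      \<Psi>, while that of F enters unchanged; this \<eta> makes the two add up to
      \<epsilon>.\<close>
    define \<eta> where "\<eta> = \<epsilon> / (1 / w (V x) + 1)"
    have den: "0 < 1 / w (V x) + 1" using wx by (simp add: add_pos_pos)
    have \<eta>: "0 < \<eta>" using \<epsilon> den by (simp add: \<eta>_def)
    have rV: "right_delta_deriv T V (D x) x" using V(1) x by (auto simp: delta_primitive_def)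
    have rF: "right_delta_deriv T F (h x) x" using F(1) x by (auto simp: delta_primitive_def)
    obtain y where y: "y \<in> T" "x < y"
      and 1: "\<And>z. z \<in> T \<Longrightarrow> x < z \<Longrightarrow> z \<le> y \<Longrightarrow> \<bar>V z - V x - D x * (z - x)\<bar> \<le> \<eta> * (z - x)"
      using rV \<eta> unfolding right_delta_deriv_def by blast
    obtain y' where y': "y' \<in> T" "x < y'"
      and 2: "\<And>z. z \<in> T \<Longrightarrow> x < z \<Longrightarrow> z \<le> y' \<Longrightarrow> \<bar>F z - F x - h x * (z - x)\<bar> \<le> \<eta> * (z - x)"
      using rF \<eta> unfolding right_delta_deriv_def by blast
    \<comment> \<open>Cutting at s keeps z inside the segment, so that \<open>V z \<in> A\<close>
      and the tangent bound applies.\<close>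
    let ?y = "min s (min y y')"
    have "(\<Psi> (V z) - F z) - (\<Psi> (V x) - F x) \<le> \<epsilon> * (z - x)" if z: "z \<in> T" "x < z" "z \<le> ?y" for z
    proof -
      have "V z - V x \<le> (h x * w (V x) + \<eta>) * (z - x)"
        using 1[of z] z mult_right_mono[OF le[OF x], of "z - x"] by (auto simp: algebra_simps)
      then have "(V z - V x) / w (V x) \<le> (h x * w (V x) + \<eta>) * (z - x) / w (V x)"
        using wx by (intro divide_right_mono) auto
      also have "\<dots> = (h x + \<eta> / w (V x)) * (z - x)" using wx by (simp add: field_simps)
      finally have "\<Psi> (V z) - \<Psi> (V x) \<le> (h x + \<eta> / w (V x)) * (z - x)"
        using \<Psi>(2)[OF VA, of "V z"] V(2)[of z] z x by auto
      moreover have "F z - F x \<ge> (h x - \<eta>) * (z - x)"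
        using 2[of z] z by (auto simp: algebra_simps)
      ultimately have "(\<Psi> (V z) - F z) - (\<Psi> (V x) - F x)
          \<le> (h x + \<eta> / w (V x)) * (z - x) - (h x - \<eta>) * (z - x)" by linarith
      also have "\<dots> = \<eta> * (1 / w (V x) + 1) * (z - x)" by (simp add: algebra_simps)
      also have "\<eta> * (1 / w (V x) + 1) = \<epsilon>" using den by (simp add: \<eta>_def)
      finally show ?thesis .
    qed
    then show "\<exists>y\<in>T. x < y \<and> (\<forall>z\<in>T. x < z \<longrightarrow> z \<le> y \<longrightarrow>
        (\<Psi> (V z) - F z) - (\<Psi> (V x) - F x) \<le> \<epsilon> * (z - x))"
      using y y' x T by (intro bexI[of _ ?y]) (auto simp: min_def)
  qed
  then show ?thesis by simp
qed

text \<open>The linear case of Bihari's comparison, with \<Psi> the identity and weight 1.\<close>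

lemma delta_primitive_mono:
  assumes "closed T" "r \<in> T" "s \<in> T" "r \<le> s"
    and "delta_primitive T r s h F" "delta_primitive T r s h' F'"
    and "\<And>x. x \<in> T \<Longrightarrow> r \<le> x \<Longrightarrow> x < s \<Longrightarrow> h x \<le> h' x"
  shows "F s - F r \<le> F' s - F' r"
  using bihari_comparison[OF assms(1-5), where A = UNIV and \<Psi> = "\<lambda>x. x" and w = "\<lambda>_. 1", OF _ assms(6)] assms(7)
  by auto

lemma delta_primitive_nonneg:
  assumes "closed T" "r \<in> T" "s \<in> T" "r \<le> s" "delta_primitive T r s h F"
    and "\<And>x. x \<in> T \<Longrightarrow> r \<le> x \<Longrightarrow> x < s \<Longrightarrow> 0 \<le> h x"
  shows "F r \<le> F s"
  using delta_primitive_mono[OF assms(1-4) delta_primitive_const[OF assms(3), where c = 0] assms(5)] assms(6) by auto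

section \<open>Delta integrals through primitives\<close>

lemma has_delta_integral_imp_primitive:
  assumes "closed T" "s \<in> T" "has_delta_integral T r s h I"
  obtains F where "delta_primitive T r s h F" "I = F s - F r"
proof -
  obtain F where F: "continuous_on (T \<inter> {r..s}) F"
    "\<And>t. t \<in> T \<inter> {r..<s} \<Longrightarrow> has_delta_deriv (T \<inter> {r..s}) F (h t) t" "I = F s - F r"
    using assms(3) unfolding has_delta_integral_def by auto
  then have "delta_primitive T r s h F"
    unfolding delta_primitive_def
    using assms(1,2)
    by (auto intro!: right_delta_deriv_segment[of T r s] has_delta_deriv_imp_right[of "T \<inter> {r..s}" s])
  then show ?thesis using F(3) that by auto
qed

text \<open>Comparing two primitives of h in both directions shows that their increments agree, so
  the definite description has a unique candidate. Integrability is a separate assumption because a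
  primitive with right-hand derivatives only need not witness
  \<open>has_delta_integral\<close>.\<close>

lemma delta_integral_eq:
  assumes T: "closed T" "r \<in> T" "s \<in> T" "r \<le> s"
    and F: "delta_primitive T r s h F" and "delta_integrable T r s h"
  shows "delta_integral T r s h = F s - F r"
proof -
  have eq: "I = F s - F r" if "has_delta_integral T r s h I" for I
    using has_delta_integral_imp_primitive[OF T(1,3) that]
      delta_primitive_mono[OF T F] delta_primitive_mono[OF T _ F] by (metis order.refl order.antisym)
  then show ?thesis
    using assms(6) unfolding delta_integrable_def delta_integral_def by (metis the_equality)
qed

lemma delta_integrable_imp_primitive:
  assumes T: "closed T" "r \<in> T" "s \<in> T" "r \<le> s" "delta_integrable T r s h"
  obtains F where "delta_primitive T r s h F" "delta_integral T r s h = F s - F r"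
  using assms delta_integral_eq has_delta_integral_imp_primitive
  unfolding delta_integrable_def by metis

text \<open>Lets integrand and upper limit grow together, as happens for the integrals of
  \<open>k s\<close> from a to s, where s occurs in both places.\<close>

lemma delta_integral_mono:
  assumes T: "closed T" "r \<in> T" "s \<in> T" "r \<le> s" "s' \<in> T" "s \<le> s'"
    and h: "delta_integrable T r s h" "delta_integrable T r s' h'"
    and le: "\<And>x. x \<in> T \<Longrightarrow> r \<le> x \<Longrightarrow> x < s \<Longrightarrow> h x \<le> h' x"
    and nn: "\<And>x. x \<in> T \<Longrightarrow> s \<le> x \<Longrightarrow> x < s' \<Longrightarrow> 0 \<le> h' x"
  shows "delta_integral T r s h \<le> delta_integral T r s' h'"
proof -
  obtain F where F: "delta_primitive T r s h F" "delta_integral T r s h = F s - F r"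
    using delta_integrable_imp_primitive[OF T(1-4) h(1)] .
  obtain F' where F': "delta_primitive T r s' h' F'" "delta_integral T r s' h' = F' s' - F' r"
    using delta_integrable_imp_primitive[OF T(1,2,5) _ h(2)] T(4,6) by auto
  have "F s - F r \<le> F' s - F' r"
    by (rule delta_primitive_mono[OF T(1-4) F(1) delta_primitive_subset[OF F'(1)]]) (use T le in auto)
  moreover have "F' s \<le> F' s'"
    using delta_primitive_nonneg[OF T(1,3,5,6) delta_primitive_subset[OF F'(1)]] T nn by auto
  ultimately show ?thesis using F F' by simp
qed

lemma delta_integral_nonneg:
  assumes "closed T" "r \<in> T" "s \<in> T" "r \<le> s" "delta_integrable T r s h"
    and "\<And>x. x \<in> T \<Longrightarrow> r \<le> x \<Longrightarrow> x < s \<Longrightarrow> 0 \<le> h x"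
  shows "0 \<le> delta_integral T r s h"
  using delta_integrable_imp_primitive[OF assms(1-5)] delta_primitive_nonneg[OF assms(1-4)] assms(6)
  by (metis diff_ge_0_iff_ge)

lemma delta_integral_eq_0:
  assumes T: "closed T" "r \<in> T" "s \<in> T" "r \<le> s" and h: "delta_integrable T r s h"
    and "\<And>x. x \<in> T \<Longrightarrow> r \<le> x \<Longrightarrow> x < s \<Longrightarrow> h x = 0"
  shows "delta_integral T r s h = 0"
  using delta_integral_eq[OF T delta_primitive_cong[OF delta_primitive_const[OF T(3), where c = 0]] h] assms(6)
  by simp

text \<open>The primitive is nondecreasing with total increment 0, hence constant, so its right
  derivative vanishes. As h is a right derivative at every point before s, nothing is lost on a null
  set.\<close>

lemma delta_integral_eq_0_imp:
  assumes T: "closed T" "r \<in> T" "s \<in> T" "r \<le> s" and h: "delta_integrable T r s h"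
    and nn: "\<And>x. x \<in> T \<Longrightarrow> r \<le> x \<Longrightarrow> x < s \<Longrightarrow> 0 \<le> h x"
    and 0: "delta_integral T r s h = 0"
    and x: "x \<in> T" "r \<le> x" "x < s"
  shows "h x = 0"
proof -
  obtain F where F: "delta_primitive T r s h F" "delta_integral T r s h = F s - F r"
    using delta_integrable_imp_primitive[OF T h] .
  have const: "F z = F r" if z: "z \<in> T" "r \<le> z" "z \<le> s" for z
  proof -
    have "F r \<le> F z"
      by (rule delta_primitive_nonneg[OF T(1,2) z(1,2) delta_primitive_subset[OF F(1)]])
        (use z nn in auto)
    moreover have "F z \<le> F s"
      by (rule delta_primitive_nonneg[OF T(1) z(1) T(3) z(3) delta_primitive_subset[OF F(1)]])
        (use z nn in auto)
    ultimately show ?thesis using F(2) 0 by simp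
  qed
  have "\<bar>h x\<bar> \<le> \<epsilon>" if "0 < \<epsilon>" for \<epsilon>
  proof -
    have "right_delta_deriv T F (h x) x" using F(1) x by (auto simp: delta_primitive_def)
    then obtain y where y: "y \<in> T" "x < y"
      and le: "\<And>z. z \<in> T \<Longrightarrow> x < z \<Longrightarrow> z \<le> y \<Longrightarrow> \<bar>F z - F x - h x * (z - x)\<bar> \<le> \<epsilon> * (z - x)"
      using \<open>0 < \<epsilon>\<close> unfolding right_delta_deriv_def by blast
    let ?z = "min y s"
    have z: "?z \<in> T" "x < ?z" "?z \<le> y" "?z \<le> s" using y x T by (auto simp: min_def)
    then have "\<bar>h x * (?z - x)\<bar> \<le> \<epsilon> * (?z - x)" using le[of ?z] const[of ?z] const[of x] x by auto
    then show ?thesis using z by (simp add: abs_mult)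
  qed
  from this[of "\<bar>h x\<bar> / 2"] show "h x = 0" by (cases "h x = 0") auto
qed

section \<open>The functions G and \<Psi> and their inverses\<close>

text \<open>Serves G with w = g and \<Psi> with w the composition of \<Phi> and W. The derivative 1
  / w of P is nonincreasing, so the mean value theorem gives the tangent bound on either side of
  x.\<close>

lemma primitive_of_reciprocal:
  fixes w P :: "real \<Rightarrow> real" and c :: real
  assumes w: "continuous_on {0..} w" "mono_on {0..} w" "\<And>x. 0 < x \<Longrightarrow> 0 < w x"
    and c: "0 < c" and P: "P = (\<lambda>x. LBINT s=c..x. 1 / w s)"
  shows "continuous_on {0<..} P"
    and "\<And>x y. 0 < x \<Longrightarrow> 0 < y \<Longrightarrow> P y - P x \<le> (y - x) / w x"
    and "strict_mono_on {0<..} P"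
proof -
  have deriv: "(P has_real_derivative 1 / w x) (at x)" if x: "0 < x" for x
  proof -
    \<comment> \<open>A compact interval of positive reals around c and x: w may vanish at 0, and x
      must be interior for the two-sided derivative.\<close>
    let ?l = "min c x / 2" and ?u = "max c x + 1"
    have "\<And>s. s \<in> {?l..?u} \<Longrightarrow> 0 < w s" using c x w(3) by (auto simp: min_def split: if_splits)
    moreover have "{?l..?u} \<subseteq> {0..}" using c x by auto
    ultimately have "continuous_on {?l..?u} (\<lambda>s. 1 / w s)"
      by (intro continuous_on_divide continuous_on_const continuous_on_subset[OF w(1)]) force+
    then have "((\<lambda>y. LBINT s=c..y. 1 / w s) has_vector_derivative 1 / w x) (at x within {?l..?u})"
      by (intro interval_integral_FTC2) (use c x in auto)
    then have "(P has_real_derivative 1 / w x) (at x within {?l..?u})"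
      by (simp add: P has_real_derivative_iff_has_vector_derivative)
    moreover have "x \<in> interior {?l..?u}" using x c by (auto simp: interior_atLeastAtMost_real min_def max_def)
    ultimately show ?thesis by (metis at_within_interior)
  qed
  show "continuous_on {0<..} P"
    using deriv by (intro continuous_at_imp_continuous_on) (auto intro: DERIV_isCont)
  have mvt: "\<exists>z. x < z \<and> z < y \<and> P y - P x = (y - x) / w z" if "0 < x" "x < y" for x y
    using MVT2[OF that(2), of P "\<lambda>z. 1 / w z"] deriv that by force
  show "P y - P x \<le> (y - x) / w x" if xy: "0 < x" "0 < y" for x y
  proof (cases x y rule: linorder_cases)
    case less
    then obtain z where z: "x < z" "z < y" "P y - P x = (y - x) / w z" using mvt xy by blast
    have "w x \<le> w z" using z xy by (intro mono_onD[OF w(2)]) auto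
    then have "(y - x) / w z \<le> (y - x) / w x" using less w(3)[OF xy(1)] by (intro divide_left_mono) auto
    then show ?thesis using z by simp
  next
    case greater
    then obtain z where z: "y < z" "z < x" "P x - P y = (x - y) / w z" using mvt xy by blast
    have "w z \<le> w x" using z xy by (intro mono_onD[OF w(2)]) auto
    then have "(x - y) / w x \<le> (x - y) / w z" using greater w(3)[of z] z xy by (intro divide_left_mono) auto
    moreover have "(y - x) / w x = - ((x - y) / w x)" by (simp add: minus_divide_left)
    ultimately show ?thesis using z by linarith
  qed simp
  show "strict_mono_on {0<..} P"
  proof (rule strict_mono_onI)
    fix x y :: real assume xy: "x \<in> {0<..}" "y \<in> {0<..}" "x < y"
    then obtain z where z: "x < z" "z < y" "P y - P x = (y - x) / w z" using mvt by auto
    then have "0 < (y - x) / w z" using w(3)[of z] xy by auto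
    then show "P x < P y" using z by simp
  qed
qed

text \<open>The range is an interval, so a domain condition on an inverse at a late time passes to
  earlier times.\<close>

lemma between_in_image:
  fixes P :: "real \<Rightarrow> real"
  assumes "continuous_on {0<..} P" "x \<in> P ` {0<..}" "z \<in> P ` {0<..}" "x \<le> y" "y \<le> z"
  shows "y \<in> P ` {0<..}"
proof -
  have "connected (P ` {0<..})" by (intro connected_continuous_image assms connected_Ioi)
  then show ?thesis using assms connectedD_interval by blast
qed

lemma le_inv_into:
  fixes P :: "real \<Rightarrow> real"
  assumes "strict_mono_on A P" "x \<in> A" "v \<in> P ` A" "P x \<le> v"
  shows "x \<le> inv_into A P v"
  using assms f_inv_into_f[OF assms(3)] inv_into_into[OF assms(3)]
  by (metis linorder_not_less strict_mono_onD)

section \<open>Monotonicity of the kernel in its first argument\<close>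

text \<open>As a function of z, \<open>k z \<tau>\<close> is a primitive of its nonnegative delta
  derivative on [s, t]. Admissibility speaks only of points above a, so the lower point s must
  exceed a.\<close>

lemma admissible_kernel_mono:
  assumes T: "closed T" and adm: "admissible_kernel T a k"
    and nn: "\<And>t s D. t \<in> ts_kappa T \<Longrightarrow> s \<in> ts_kappa T \<Longrightarrow> s \<le> t \<Longrightarrow>
      has_delta_deriv T (\<lambda>x. k x s) D t \<Longrightarrow> 0 \<le> D"
    and a: "\<And>t. t \<in> T \<Longrightarrow> a \<le> t"
    and x: "a < s" "\<tau> \<le> s" "s \<le> t" "\<tau> \<in> ts_kappa T" "s \<in> ts_kappa T" "t \<in> ts_kappa T"
  shows "k s \<tau> \<le> k t \<tau>"
proof -
  have in_T: "z \<in> T" if "z \<in> ts_kappa T" for z using that by (auto simp: ts_kappa_def)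
  have kap: "z \<in> ts_kappa T" if "z \<in> T" "z \<le> t" for z
    using that x(6) in_T[OF x(6)] by (cases "z = t") (simp, force simp: ts_kappa_def)
  \<comment> \<open>Read at a single \<tau>, the uniform estimate of admissibility says that
    \<open>delta_deriv1 T k z \<tau>\<close> is a delta derivative; \<tau> \<le> s \<le> z puts
    \<tau> in the range [a, \<sigma>(z)] where the estimate is available.\<close>
  have D: "has_delta_deriv T (\<lambda>x. k x \<tau>) (delta_deriv1 T k z \<tau>) z" if z: "z \<in> T" "s \<le> z" "z \<le> t" for z
  proof -
    have "z \<le> fwd_jump T z" using closed_fwd_jump(2)[OF T, of _ z]
      by (cases "\<exists>y\<in>T. z < y") (blast, simp add: fwd_jump_def)
    then have \<tau>: "\<tau> \<in> ts_kappa T \<inter> {a..fwd_jump T z}" using x z a[OF in_T[OF x(4)]] by auto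
    show ?thesis
      unfolding has_delta_deriv_def
    proof (intro conjI allI impI)
      show zk: "z \<in> ts_kappa T" using kap z by simp
      fix \<epsilon> :: real assume "0 < \<epsilon>"
      with adm zk x z \<tau> show "\<exists>d>0. \<forall>s\<in>T. \<bar>s - z\<bar> < d \<longrightarrow>
          \<bar>k (fwd_jump T z) \<tau> - k s \<tau> - delta_deriv1 T k z \<tau> * (fwd_jump T z - s)\<bar>
          \<le> \<epsilon> * \<bar>fwd_jump T z - s\<bar>"
        unfolding admissible_kernel_def by (meson less_le_trans)
    qed
  qed
  have "delta_primitive T s t (\<lambda>z. delta_deriv1 T k z \<tau>) (\<lambda>z. k z \<tau>)"
    unfolding delta_primitive_def
  proof (intro conjI ballI)
    show "continuous_on (T \<inter> {s..t}) (\<lambda>z. k z \<tau>)"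
      unfolding continuous_on_eq_continuous_within
      by (intro ballI continuous_within_subset[OF has_delta_deriv_continuous[OF _ D]]) auto
    fix z assume z: "z \<in> T \<inter> {s..<t}"
    show "right_delta_deriv T (\<lambda>z. k z \<tau>) (delta_deriv1 T k z \<tau>) z"
      using has_delta_deriv_imp_right[OF T in_T[OF x(6)] _ _ D] z by auto
  qed
  note nonneg = delta_primitive_nonneg[OF T in_T[OF x(5)] in_T[OF x(6)] x(3) this]
  show ?thesis
  proof (rule nonneg)
    fix z assume "z \<in> T" "s \<le> z" "z < t"
    then show "0 \<le> delta_deriv1 T k z \<tau>" using x kap by (intro nn[OF _ x(4) _ D]) auto
  qed
qed

section \<open>The explicit bound on u\<close>

theorem theorem3:
  fixes T Ts :: "real set" and a b x0 \<delta> \<zeta> :: real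
    and u f \<alpha> \<Phi> W g \<Psi> G q :: "real \<Rightarrow> real"
    and k :: "real \<Rightarrow> real \<Rightarrow> real"
  assumes "time_scale T" and "a \<in> T" and "b \<in> T" and "a < b"
    and Ts: "Ts = T \<inter> {a..b}"
    and u: "rd_continuous_on Ts Ts u" "\<forall>t\<in>Ts. 0 \<le> u t"
    and f: "rd_continuous_on Ts (ts_kappa Ts) f" "\<forall>t\<in>ts_kappa Ts. 0 \<le> f t"
    and k_adm: "admissible_kernel Ts a k"
    and k_nonneg: "\<forall>t\<in>Ts. \<forall>s\<in>ts_kappa Ts. s \<le> t \<longrightarrow> 0 \<le> k t s"
    and k_deriv_nonneg:
      "\<forall>t\<in>ts_kappa Ts. \<forall>s\<in>ts_kappa Ts. \<forall>D.
         s \<le> t \<longrightarrow> has_delta_deriv Ts (\<lambda>x. k x s) D t \<longrightarrow> 0 \<le> D"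
    and k_nonzero: "\<exists>t\<in>ts_kappa Ts. \<exists>s\<in>ts_kappa (ts_kappa Ts). k t s \<noteq> 0"
    and \<Phi>: "nondecr_cont_nonneg \<Phi>" "subadditive_nonneg \<Phi>" "submultiplicative_nonneg \<Phi>"
      "\<forall>x>0. 0 < \<Phi> x"
    and W: "nondecr_cont_nonneg W" "\<forall>x>0. 0 < W x"
    and g: "class_S g"
    and \<alpha>: "\<forall>t\<in>Ts. 0 < \<alpha> t" "rd_continuous_on Ts Ts \<alpha>" "mono_on Ts \<alpha>"
    and "0 < x0" and "0 < \<delta>"
    and \<Psi>: "\<Psi> = (\<lambda>x. LBINT s=x0..x. 1 / \<Phi> (W s))"
    and G: "G = (\<lambda>x. LBINT s=\<delta>..x. 1 / g s)"
    and q: "q = (\<lambda>t. inv_into {0<..} G (G 1 + delta_integral Ts a t f))"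
    and \<zeta>: "\<zeta> = delta_integral Ts a (bwd_jump Ts b)
                 (\<lambda>s. k (bwd_jump Ts b) s * \<Phi> (q s * max (\<alpha> s) 1))"
    and q_defined: "\<forall>s\<in>Ts. s < bwd_jump Ts b \<longrightarrow> G 1 + delta_integral Ts a s f \<in> G ` {0<..}"
    and integrals_exist:
      "\<forall>t\<in>Ts. delta_integrable Ts a t f"
      "\<forall>t\<in>Ts. delta_integrable Ts a t (\<lambda>s. f s * g (u s))"
      "\<forall>s\<in>Ts. s < b \<longrightarrow> delta_integrable Ts a s (\<lambda>\<tau>. k s \<tau> * \<Phi> (u \<tau>))"
      "\<forall>t\<in>Ts. delta_integrable Ts a t
         (\<lambda>s. f s * W (delta_integral Ts a s (\<lambda>\<tau>. k s \<tau> * \<Phi> (u \<tau>))))"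
      "delta_integrable Ts a (bwd_jump Ts b)
         (\<lambda>s. k (bwd_jump Ts b) s * \<Phi> (q s * max (\<alpha> s) 1))"
    and ineq:
      "\<forall>t\<in>Ts. u t \<le> \<alpha> t + delta_integral Ts a t (\<lambda>s. f s * g (u s))
         + delta_integral Ts a t
             (\<lambda>s. f s * W (delta_integral Ts a s (\<lambda>\<tau>. k s \<tau> * \<Phi> (u \<tau>))))"
  shows
    "\<forall>t\<in>Ts.
       G 1 + delta_integral Ts a t f \<in> G ` {0<..} \<longrightarrow>
       (\<forall>s\<in>Ts. s \<le> bwd_jump Ts t \<longrightarrow>
          delta_integrable Ts a s (\<lambda>\<tau>. k s \<tau> * \<Phi> (q \<tau>) * \<Phi> (delta_integral Ts a \<tau> f))) \<longrightarrow>
       \<Psi> \<zeta> + delta_integral Ts a (bwd_jump Ts t)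
               (\<lambda>\<tau>. k (bwd_jump Ts t) \<tau> * \<Phi> (q \<tau>) * \<Phi> (delta_integral Ts a \<tau> f)) \<in> \<Psi> ` {0<..} \<longrightarrow>
       delta_integrable Ts a t
         (\<lambda>s. f s * W (inv_into {0<..} \<Psi> (\<Psi> \<zeta> + delta_integral Ts a s
               (\<lambda>\<tau>. k s \<tau> * \<Phi> (q \<tau>) * \<Phi> (delta_integral Ts a \<tau> f))))) \<longrightarrow>
       u t \<le> q t * max (\<alpha> t) 1 + q t * delta_integral Ts a t
         (\<lambda>s. f s * W (inv_into {0<..} \<Psi> (\<Psi> \<zeta> + delta_integral Ts a s
               (\<lambda>\<tau>. k s \<tau> * \<Phi> (q \<tau>) * \<Phi> (delta_integral Ts a \<tau> f)))))"
proof -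
  define y where "y s = delta_integral Ts a s (\<lambda>\<tau>. k s \<tau> * \<Phi> (u \<tau>))" for s
  define n where "n t = max (\<alpha> t) 1 + delta_integral Ts a t (\<lambda>s. f s * W (y s))" for t
  define I where "I t = delta_integral Ts a t f" for t
  define p where "p \<tau> = \<Phi> (q \<tau>) * \<Phi> (I \<tau>)" for \<tau>
  define \<phi> where "\<phi> x = \<Phi> (W x)" for x
  let ?\<beta> = "bwd_jump Ts b"

  \<comment> \<open>Points of the time scale and the sign of the kernel\<close>
  have cl: "closed Ts" using assms(1) by (auto simp: Ts time_scale_def)
  have aT: "a \<in> Ts" and bT: "b \<in> Ts" and Ts_bounds: "\<And>t. t \<in> Ts \<Longrightarrow> a \<le> t \<and> t \<le> b"
    using assms(2-4) by (auto simp: Ts)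
  have kap: "t \<in> ts_kappa Ts" if "t \<in> Ts" "t < b" for t
    using that bT by (force simp: ts_kappa_def)
  have \<beta>T: "?\<beta> \<in> Ts" "?\<beta> \<le> b" using closed_bwd_jump[OF cl bT] by auto
  have \<beta>_ge: "s \<le> ?\<beta>" if "s \<in> Ts" "s < b" for s using closed_bwd_jump(3)[OF cl bT that] .
  \<comment> \<open>If s = b, then \<rho>(b) = b, so b is not left-scattered and
    \<open>ts_kappa\<close> keeps it.\<close>
  have kap\<beta>: "s \<in> ts_kappa Ts" if "s \<in> Ts" "s \<le> ?\<beta>" for s
    using that kap[of s] Ts_bounds[of s] by (cases "s = b") (simp add: ts_kappa_def, force)
  have k_nn: "0 \<le> k s \<tau>" if "s \<in> Ts" "\<tau> \<in> Ts" "\<tau> \<le> s" "\<tau> < b" for s \<tau>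
    using k_nonneg kap that by auto
  have k_mono: "k s \<tau> \<le> k t \<tau>" if "s \<in> Ts" "t \<in> Ts" "\<tau> \<in> Ts" "a < s" "\<tau> \<le> s" "s \<le> t" "t \<le> ?\<beta>" for s t \<tau>
    by (rule admissible_kernel_mono[OF cl k_adm])
      (use k_deriv_nonneg that kap\<beta> Ts_bounds in auto)

  \<comment> \<open>Monotonicity and positivity of the nonlinearities\<close>
  have W_nn: "0 \<le> W x" if "0 \<le> x" for x using W(1) that by (auto simp: nondecr_cont_nonneg_def)
  have \<Phi>_nn: "0 \<le> \<Phi> x" if "0 \<le> x" for x using \<Phi>(1) that by (auto simp: nondecr_cont_nonneg_def)
  have W_mono: "W x \<le> W z" if "0 \<le> x" "x \<le> z" for x z
    using W(1) that by (auto simp: nondecr_cont_nonneg_def mono_on_def)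
  have \<Phi>_mono: "\<Phi> x \<le> \<Phi> z" if "0 \<le> x" "x \<le> z" for x z
    using \<Phi>(1) that by (auto simp: nondecr_cont_nonneg_def mono_on_def)
  have g_nn: "0 \<le> g x" if "0 \<le> x" for x using g that by (auto simp: class_S_def nondecr_cont_nonneg_def)
  have g_mono: "g x \<le> g z" if "0 \<le> x" "x \<le> z" for x z
    using g that by (auto simp: class_S_def nondecr_cont_nonneg_def mono_on_def)
  have g_pos: "0 < g x" if "0 < x" for x using g that by (auto simp: class_S_def)
  have \<phi>_mono: "\<phi> x \<le> \<phi> z" if "0 \<le> x" "x \<le> z" for x z
    using that by (auto simp: \<phi>_def intro!: \<Phi>_mono W_mono W_nn)
  have \<phi>_pos: "0 < \<phi> x" if "0 < x" for x using W(2) \<Phi>(4) that by (auto simp: \<phi>_def)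
  have f_nn: "0 \<le> f t" if "t \<in> Ts" "t < b" for t using f(2) kap that by auto
  have u_nn: "0 \<le> u t" if "t \<in> Ts" for t using u(2) that by auto
  have contg: "continuous_on {0..} g" and mg: "mono_on {0..} g"
    using g by (auto simp: class_S_def nondecr_cont_nonneg_def)
  have "continuous_on {0..} (\<lambda>x. \<Phi> (W x))"
    by (rule continuous_on_compose2[of "{0..}" \<Phi> "{0..}" W])
      (use \<Phi>(1) W(1) in \<open>auto simp: nondecr_cont_nonneg_def\<close>)
  then have cont\<phi>: "continuous_on {0..} \<phi>" by (simp add: \<phi>_def[abs_def])
  have m\<phi>: "mono_on {0..} \<phi>" using \<phi>_mono by (auto intro: mono_onI)
  have G': "G = (\<lambda>x. LBINT s=\<delta>..x. 1 / g s)" and \<Psi>': "\<Psi> = (\<lambda>x. LBINT s=x0..x. 1 / \<phi> s)"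
    using G \<Psi> by (auto simp: \<phi>_def)
  note GP = primitive_of_reciprocal[OF contg mg g_pos \<open>0 < \<delta>\<close> G']
  note PP = primitive_of_reciprocal[OF cont\<phi> m\<phi> \<phi>_pos \<open>0 < x0\<close> \<Psi>']

  \<comment> \<open>The integral of f and the size of q\<close>
  have I_int: "delta_integrable Ts a t f" if "t \<in> Ts" for t using integrals_exist(1) that by auto
  have I_mono: "I s \<le> I t" if "s \<in> Ts" "t \<in> Ts" "s \<le> t" for s t
    unfolding I_def by (rule delta_integral_mono[OF cl aT])
      (use that Ts_bounds[OF that(1)] Ts_bounds[OF that(2)] I_int f_nn in auto)
  have Ia: "I a = 0" unfolding I_def
    by (rule delta_integral_eq_0[OF cl aT aT]) (use I_int aT in auto)
  have I_nn: "0 \<le> I t" if "t \<in> Ts" for t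
    using I_mono[OF aT that] Ts_bounds[OF that] Ia by simp
  have G_range: "G 1 + I s \<in> G ` {0<..}" if "s \<in> Ts" "t \<in> Ts" "s \<le> t" "G 1 + I t \<in> G ` {0<..}" for s t
    by (rule between_in_image[OF GP(1) _ that(4), of "G 1"]) (use I_nn I_mono that in auto)
  have q_ge_1: "1 \<le> q s" if "s \<in> Ts" "G 1 + I s \<in> G ` {0<..}" for s
    unfolding q I_def[symmetric]
    by (rule le_inv_into[OF GP(3)]) (use that I_nn in auto)

  \<comment> \<open>The kernel integral y and the majorant n\<close>
  have y_int: "delta_integrable Ts a s (\<lambda>\<tau>. k s \<tau> * \<Phi> (u \<tau>))" if "s \<in> Ts" "s < b" for s
    using integrals_exist(3) that by auto
  have y_nn: "0 \<le> y s" if "s \<in> Ts" "s < b" for s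
    unfolding y_def by (rule delta_integral_nonneg[OF cl aT])
      (use that Ts_bounds y_int in \<open>auto intro!: mult_nonneg_nonneg k_nn \<Phi>_nn u_nn\<close>)
  have ya: "y a = 0" unfolding y_def
    by (rule delta_integral_eq_0[OF cl aT aT]) (use y_int aT assms(4) in auto)
  have y_mono: "y s \<le> y s'" if "s \<in> Ts" "s' \<in> Ts" "s \<le> s'" "s' < b" for s s'
  \<comment> \<open>The left endpoint is separate because kernel monotonicity starts only above a;
    there y vanishes.\<close>
  proof (cases "s = a")
    case False
    then have "a < s" using Ts_bounds that by force
    show ?thesis unfolding y_def
      by (intro delta_integral_mono[OF cl aT])
        (use \<open>a < s\<close> that Ts_bounds y_int \<beta>_ge in \<open>auto intro!: mult_nonneg_nonneg mult_right_mono k_mono k_nn \<Phi>_nn u_nn\<close>)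
  qed (use ya y_nn that in auto)
  have fW_int: "delta_integrable Ts a t (\<lambda>s. f s * W (y s))" if "t \<in> Ts" for t
    using integrals_exist(4) that by (auto simp: y_def)
  have fW_nn: "0 \<le> f s * W (y s)" if "s \<in> Ts" "s < b" for s
    using that f_nn W_nn y_nn by auto
  let ?fW = "\<lambda>t. delta_integral Ts a t (\<lambda>s. f s * W (y s))"
  have fW_nonneg: "0 \<le> ?fW t" if "t \<in> Ts" for t
    by (rule delta_integral_nonneg[OF cl aT that])
      (use Ts_bounds[OF that] fW_int[OF that] fW_nn in auto)
  have n_mono: "n s \<le> n t" if "s \<in> Ts" "t \<in> Ts" "s \<le> t" for s t
  proof -
    have "\<alpha> s \<le> \<alpha> t" using \<alpha>(3) that by (auto simp: mono_on_def)
    moreover have "?fW s \<le> ?fW t"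
      by (rule delta_integral_mono[OF cl aT])
        (use that Ts_bounds[OF that(1)] Ts_bounds[OF that(2)] fW_int fW_nn in auto)
    ultimately show ?thesis unfolding n_def by (intro add_mono) auto
  qed
  have n_ge_1: "1 \<le> n t" if "t \<in> Ts" for t
    using fW_nonneg[OF that] by (auto simp: n_def)

  \<comment> \<open>First comparison: u against q and n\<close>
  have u_le: "u t \<le> q t * n t" if t: "t \<in> Ts" and range: "G 1 + I t \<in> G ` {0<..}" for t
  proof -
    have at: "a \<le> t" "t \<le> b" using Ts_bounds t by auto
    have g_int: "delta_integrable Ts a s (\<lambda>s. f s * g (u s))" if "s \<in> Ts" for s
      using integrals_exist(2) that by auto
    obtain F where F: "delta_primitive Ts a t f F" "I t = F t - F a"
      using delta_integrable_imp_primitive[OF cl aT t at(1) I_int[OF t]] unfolding I_def .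
    obtain H where H: "delta_primitive Ts a t (\<lambda>s. f s * g (u s)) H"
      using delta_integrable_imp_primitive[OF cl aT t at(1) g_int[OF t]] .
    \<comment> \<open>The majorant is frozen at its largest value on [a, t]; N \<ge> 1 is what class
      S needs to move the factor 1 / N inside g.\<close>
    define N where "N = n t"
    have N: "1 \<le> N" using n_ge_1[OF t] by (simp add: N_def)
    \<comment> \<open>Shaped for \<open>delta_primitive_affine\<close> with c' = 0;
      \<open>w_eq\<close> gives the working form, in which w a = 1 is the source of
      \<open>G 1\<close> in q.\<close>
    define w where "w s = (1 - H a / N) + (1 / N) * H s + 0 * F s" for s
    have w_eq: "w s = 1 + (H s - H a) / N" for s using N by (simp add: w_def field_simps)
    have H_nn: "H a \<le> H s" if "s \<in> Ts" "s \<le> t" for s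
      by (rule delta_primitive_nonneg[OF cl aT that(1) _ delta_primitive_subset[OF H]])
        (use Ts_bounds that at f_nn g_nn u_nn in auto)
    have w_pos: "1 \<le> w s" if "s \<in> Ts" "s \<le> t" for s using H_nn[OF that] N by (simp add: w_eq)
    have uw: "u s / N \<le> w s" if s: "s \<in> Ts" "s \<le> t" for s
    proof -
      have "delta_integral Ts a s (\<lambda>s. f s * g (u s)) = H s - H a"
        by (rule delta_integral_eq[OF cl aT s(1) _ delta_primitive_subset[OF H]])
          (use Ts_bounds s g_int in auto)
      then have "u s \<le> \<alpha> s + (H s - H a) + ?fW s"
        using bspec[OF ineq s(1)] by (simp add: y_def)
      also have "\<dots> \<le> n s + (H s - H a)" by (simp add: n_def)
      also have "\<dots> \<le> N + (H s - H a)" using n_mono[OF s(1) t s(2)] by (simp add: N_def)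
      finally show ?thesis using N by (simp add: w_eq field_simps)
    qed
    have "G (w t) \<le> G (w a) + (F t - F a)"
    proof (rule bihari_comparison[OF cl aT t at(1), where A = "{0<..}" and w = g and V = w and \<Psi> = G])
      show "delta_primitive Ts a t (\<lambda>x. (1 / N) * (f x * g (u x)) + 0 * f x) w"
        unfolding w_def by (rule delta_primitive_affine[OF H F(1)])
      show "w x \<in> {0<..}" if "x \<in> Ts" "a \<le> x" "x \<le> t" for x
        using w_pos[of x] that by auto
      fix x assume x: "x \<in> Ts" "a \<le> x" "x < t"
      have "1 / N * g (u x) \<le> g (u x / N)" using g N u_nn[OF x(1)] by (auto simp: class_S_def)
      also have "\<dots> \<le> g (w x)" using uw[of x] x N u_nn by (intro g_mono) auto
      finally show "(1 / N) * (f x * g (u x)) + 0 * f x \<le> f x * g (w x)"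
        using f_nn[of x] x at mult_left_mono[of "1 / N * g (u x)" "g (w x)" "f x"]
        by (auto simp: algebra_simps)
    qed (use F(1) GP g_pos in auto)
    then have "G (w t) \<le> G 1 + I t" by (simp add: w_eq F(2))
    then have "w t \<le> q t"
      unfolding q I_def[symmetric]
      by (intro le_inv_into[OF GP(3) _ range]) (use w_pos[OF t] in auto)
    then have "u t / N \<le> q t" using uw[OF t] by simp
    then show ?thesis using N by (simp add: N_def field_simps)
  qed

  \<comment> \<open>The constant \<zeta> and the partial integrals below it\<close>
  have q\<beta>: "1 \<le> q s" if "s \<in> Ts" "s < ?\<beta>" for s
    using q_ge_1[OF that(1)] q_defined that by (auto simp: I_def)
  have \<zeta>_int: "delta_integrable Ts a ?\<beta> (\<lambda>s. k ?\<beta> s * \<Phi> (q s * max (\<alpha> s) 1))"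
    by (rule integrals_exist(5))
  have \<zeta>_integrand_nn: "0 \<le> k ?\<beta> s * \<Phi> (q s * max (\<alpha> s) 1)" if "s \<in> Ts" "s < ?\<beta>" for s
    using that \<beta>T q\<beta>[OF that] by (intro mult_nonneg_nonneg k_nn \<Phi>_nn) auto
  have a\<beta>: "a \<le> ?\<beta>" using Ts_bounds \<beta>T by auto
  have \<zeta>_nn: "0 \<le> \<zeta>" unfolding \<zeta>
    by (rule delta_integral_nonneg[OF cl aT \<beta>T(1) a\<beta> \<zeta>_int]) (use \<zeta>_integrand_nn in auto)
  obtain Z where Z: "delta_primitive Ts a ?\<beta> (\<lambda>s. k ?\<beta> s * \<Phi> (q s * max (\<alpha> s) 1)) Z" "\<zeta> = Z ?\<beta> - Z a"
    using delta_integrable_imp_primitive[OF cl aT \<beta>T(1) a\<beta> \<zeta>_int] unfolding \<zeta> .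
  have Z_le: "Z s - Z a \<le> \<zeta>" if "s \<in> Ts" "s \<le> ?\<beta>" for s
    using delta_primitive_nonneg[OF cl that(1) \<beta>T(1) that(2) delta_primitive_subset[OF Z(1)]]
      \<zeta>_integrand_nn Z(2) Ts_bounds that by auto

  \<comment> \<open>Second comparison: y bounded through \<Psi>\<close>
  show ?thesis
  proof (intro ballI impI)
    fix t
    assume t: "t \<in> Ts" and range0: "G 1 + delta_integral Ts a t f \<in> G ` {0<..}"
      and P_int0: "\<forall>s\<in>Ts. s \<le> bwd_jump Ts t \<longrightarrow>
          delta_integrable Ts a s (\<lambda>\<tau>. k s \<tau> * \<Phi> (q \<tau>) * \<Phi> (delta_integral Ts a \<tau> f))"
      and range\<Psi>0: "\<Psi> \<zeta> + delta_integral Ts a (bwd_jump Ts t)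
               (\<lambda>\<tau>. k (bwd_jump Ts t) \<tau> * \<Phi> (q \<tau>) * \<Phi> (delta_integral Ts a \<tau> f)) \<in> \<Psi> ` {0<..}"
      and R_int0: "delta_integrable Ts a t
         (\<lambda>s. f s * W (inv_into {0<..} \<Psi> (\<Psi> \<zeta> + delta_integral Ts a s
               (\<lambda>\<tau>. k s \<tau> * \<Phi> (q \<tau>) * \<Phi> (delta_integral Ts a \<tau> f)))))"
    define P where "P s = delta_integral Ts a s (\<lambda>\<tau>. k s \<tau> * p \<tau>)" for s
    let ?\<rho> = "bwd_jump Ts t"
    have P_eq: "delta_integral Ts a s (\<lambda>\<tau>. k s \<tau> * \<Phi> (q \<tau>) * \<Phi> (delta_integral Ts a \<tau> f)) = P s" for s
      by (simp add: P_def p_def I_def mult.assoc)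
    have range: "G 1 + I t \<in> G ` {0<..}" using range0 by (simp add: I_def)
    have P_int: "delta_integrable Ts a s (\<lambda>\<tau>. k s \<tau> * p \<tau>)" if "s \<in> Ts" "s \<le> ?\<rho>" for s
      using P_int0 that by (simp add: p_def I_def mult.assoc)
    have range\<Psi>: "\<Psi> \<zeta> + P ?\<rho> \<in> \<Psi> ` {0<..}" using range\<Psi>0 by (simp add: P_eq)
    have at: "a \<le> t" "t \<le> b" using Ts_bounds t by auto
    have \<rho>: "?\<rho> \<in> Ts" "?\<rho> \<le> t" using closed_bwd_jump[OF cl t] by auto
    have \<rho>_ge: "s \<le> ?\<rho>" if "s \<in> Ts" "s < t" for s using closed_bwd_jump(3)[OF cl t that] .
    \<comment> \<open>For t < b the point \<rho>(t) lies below b, hence at most at \<rho>(b); first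
      arguments of k thus stay where the kernel is known to be monotone.\<close>
    have \<rho>\<beta>: "?\<rho> \<le> ?\<beta>" using \<rho> \<beta>_ge[of ?\<rho>] at by (cases "t = b") (simp, force)
    have qt: "1 \<le> q s" and us: "u s \<le> q s * n s" if "s \<in> Ts" "s \<le> t" for s
      using q_ge_1 u_le G_range[OF that(1) t that(2) range] that by auto
    have p_nn: "0 \<le> p s" if "s \<in> Ts" "s \<le> t" for s
      using that qt[OF that] by (auto simp: p_def intro!: mult_nonneg_nonneg \<Phi>_nn I_nn)
    have Pa: "P a = 0" unfolding P_def
      by (rule delta_integral_eq_0[OF cl aT aT]) (use P_int aT Ts_bounds[OF \<rho>(1)] in auto)
    have P_mono: "P s \<le> P ?\<rho>" if s: "s \<in> Ts" "s < t" for s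
    proof (cases "s = a")
      case True
      have "0 \<le> P ?\<rho>" unfolding P_def
        by (rule delta_integral_nonneg[OF cl aT \<rho>(1)])
          (use Ts_bounds[OF \<rho>(1)] \<rho> P_int at in \<open>auto intro!: mult_nonneg_nonneg k_nn p_nn\<close>)
      then show ?thesis using True Pa by simp
    next
      case False
      then have "a < s" using Ts_bounds s by force
      show ?thesis unfolding P_def
        by (intro delta_integral_mono[OF cl aT])
          (use \<open>a < s\<close> s \<rho> \<rho>_ge \<rho>\<beta> P_int at in \<open>auto intro!: mult_nonneg_nonneg mult_right_mono k_mono k_nn p_nn\<close>)
    qed
    have \<Phi>u_le: "\<Phi> (u s) \<le> \<Phi> (q s * max (\<alpha> s) 1) + p s * \<phi> (y s)" if s: "s \<in> Ts" "s < t" for s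
    proof -
      have sb: "s < b" "a \<le> s" using s at Ts_bounds by auto
      have q1: "1 \<le> q s" using qt s by auto
      \<comment> \<open>y is nondecreasing, so \<open>W (y s)\<close> dominates the values of W(y)
        on [a, s) and leaves the integral.\<close>
      have fWs: "?fW s \<le> W (y s) * I s"
      proof -
        obtain F where F: "delta_primitive Ts a s f F" "I s = F s - F a"
          using delta_integrable_imp_primitive[OF cl aT s(1) sb(2) I_int[OF s(1)]] unfolding I_def .
        obtain H where H: "delta_primitive Ts a s (\<lambda>s. f s * W (y s)) H" "?fW s = H s - H a"
          using delta_integrable_imp_primitive[OF cl aT s(1) sb(2) fW_int[OF s(1)]] .
        have "H s - H a \<le> (0 + W (y s) * F s + 0 * F s) - (0 + W (y s) * F a + 0 * F a)"
          by (rule delta_primitive_mono[OF cl aT s(1) sb(2) H(1) delta_primitive_affine[OF F(1) F(1)]])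
            (use f_nn y_mono y_nn W_mono s sb in \<open>auto simp: mult.commute intro!: mult_left_mono\<close>)
        then show ?thesis by (simp add: H F algebra_simps)
      qed
      \<comment> \<open>Subadditivity splits n into its two parts; submultiplicativity then
        separates q, \<open>W (y s)\<close> and I, whose factors make up \<open>p s\<close> and
        \<open>\<phi> (y s)\<close>.\<close>
      have "\<Phi> (u s) \<le> \<Phi> (q s * n s)" using us[of s] s u_nn by (intro \<Phi>_mono) auto
      also have "\<dots> = \<Phi> (q s * max (\<alpha> s) 1 + q s * ?fW s)" by (simp add: n_def distrib_left)
      also have "\<dots> \<le> \<Phi> (q s * max (\<alpha> s) 1) + \<Phi> (q s * ?fW s)"
        using \<Phi>(2) q1 fW_nonneg[OF s(1)] by (auto simp: subadditive_nonneg_def)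
      also have "\<Phi> (q s * ?fW s) \<le> \<Phi> (q s) * \<Phi> (?fW s)"
        using \<Phi>(3) q1 fW_nonneg[OF s(1)] by (auto simp: submultiplicative_nonneg_def)
      also have "\<Phi> (q s) * \<Phi> (?fW s) \<le> \<Phi> (q s) * (\<phi> (y s) * \<Phi> (I s))"
      proof (rule mult_left_mono)
        have "\<Phi> (?fW s) \<le> \<Phi> (W (y s) * I s)" using fWs fW_nonneg[OF s(1)] by (intro \<Phi>_mono) auto
        also have "\<dots> \<le> \<phi> (y s) * \<Phi> (I s)"
          using \<Phi>(3) W_nn y_nn s sb I_nn by (auto simp: submultiplicative_nonneg_def \<phi>_def)
        finally show "\<Phi> (?fW s) \<le> \<phi> (y s) * \<Phi> (I s)" .
      qed (use \<Phi>_nn q1 in simp)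
      finally show ?thesis by (simp add: p_def mult_ac)
    qed

    have W_le: "W (y s) \<le> W (inv_into {0<..} \<Psi> (\<Psi> \<zeta> + P s))" if s: "s \<in> Ts" "s < t" for s
    proof -
      have sb: "s < b" "a \<le> s" and s\<beta>: "s \<le> ?\<beta>" using s at Ts_bounds \<beta>_ge by auto
      have "y s \<le> inv_into {0<..} \<Psi> (\<Psi> \<zeta> + P s)"
      proof (cases "\<zeta> = 0")
        case True
        \<comment> \<open>Here \<open>\<Psi> \<zeta>\<close> may lie outside the range of \<open>\<Psi>\<close> on the positive reals, or be the junk value of a
          divergent integral. But the kernel vanishes below the diagonal, so \<open>P\<close> is constantly 0 and
          the range hypothesis at \<open>\<rho>(t)\<close> speaks about \<open>\<Psi> \<zeta>\<close> itself.\<close>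
        have k0: "k x \<tau> = 0" if \<tau>: "\<tau> \<in> Ts" "a \<le> \<tau>" "\<tau> < x" and x: "x \<in> Ts" "x \<le> ?\<beta>" for x \<tau>
        proof -
          \<comment> \<open>The factor with \<Phi> is positive, so the vanishing integral forces
            k(\<rho>(b), \<tau>) = 0; monotonicity in the first argument, available because a \<le>
            \<tau> < x, carries this down to x.\<close>
          have "k ?\<beta> \<tau> * \<Phi> (q \<tau> * max (\<alpha> \<tau>) 1) = 0"
            by (rule delta_integral_eq_0_imp[OF cl aT \<beta>T(1) a\<beta> \<zeta>_int])
              (use \<zeta>_integrand_nn True \<zeta> \<tau> x in auto)
          moreover have "0 < \<Phi> (q \<tau> * max (\<alpha> \<tau>) 1)" using \<Phi>(4) q\<beta>[of \<tau>] \<tau> x by auto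
          ultimately have "k ?\<beta> \<tau> = 0" by simp
          then show ?thesis using k_mono[of x ?\<beta> \<tau>] k_nn[of x \<tau>] \<tau> x \<beta>T by auto
        qed
        have y0: "y s = 0" unfolding y_def
          by (rule delta_integral_eq_0[OF cl aT s(1) sb(2)]) (use y_int k0 s sb s\<beta> in auto)
        have P0: "P x = 0" if "x \<in> Ts" "x \<le> ?\<rho>" for x
          unfolding P_def
          by (rule delta_integral_eq_0[OF cl aT that(1)])
            (use Ts_bounds[OF that(1)] P_int k0 that \<rho>\<beta> in auto)
        have "\<Psi> \<zeta> + P s \<in> \<Psi> ` {0<..}" using range\<Psi> P0 \<rho> s \<rho>_ge by auto
        then show ?thesis using inv_into_into[of "\<Psi> \<zeta> + P s" \<Psi> "{0<..}"] y0 by simp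
      next
        case False
        then have \<zeta>_pos: "0 < \<zeta>" using \<zeta>_nn by simp
        \<comment> \<open>The shift by \<epsilon> keeps V and \<open>\<epsilon> + y s\<close>
          positive even where y vanishes, since \<Psi> is controlled only at positive
          arguments.\<close>
        have y\<epsilon>: "\<Psi> (\<epsilon> + y s) \<le> \<Psi> (\<epsilon> + \<zeta>) + P s" if \<epsilon>: "0 < \<epsilon>" for \<epsilon>
        proof -
          obtain Y where Y: "delta_primitive Ts a s (\<lambda>\<tau>. k s \<tau> * \<Phi> (u \<tau>)) Y" "y s = Y s - Y a"
            using delta_integrable_imp_primitive[OF cl aT s(1) sb(2) y_int[OF s(1) sb(1)]] unfolding y_def .
          obtain Q where Q: "delta_primitive Ts a s (\<lambda>\<tau>. k s \<tau> * p \<tau>) Q" "P s = Q s - Q a"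
            using delta_integrable_imp_primitive[OF cl aT s(1) sb(2) P_int[OF s(1) \<rho>_ge[OF s]]] unfolding P_def .
          \<comment> \<open>V starts at \<open>\<epsilon> + \<zeta>\<close>. Subtracting Z cancels
            the \<open>max\<close> term in the bound for \<Phi>(u), and since Z gains at most
            \<zeta>, V stays above \<open>\<epsilon> + y x\<close>.\<close>
          define V where "V x = (\<epsilon> + \<zeta> - Y a + Z a) + 1 * Y x + (-1) * Z x" for x
          have yV: "y x \<le> Y x - Y a" if x: "x \<in> Ts" "x \<le> s" for x
          proof (cases "x = a")
            case False
            then have ax: "a < x" using Ts_bounds x by force
            obtain Yx where Yx: "delta_primitive Ts a x (\<lambda>\<tau>. k x \<tau> * \<Phi> (u \<tau>)) Yx" "y x = Yx x - Yx a"
              using delta_integrable_imp_primitive[OF cl aT x(1) _ y_int[OF x(1)]] ax x sb unfolding y_def by auto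
            show ?thesis unfolding Yx(2)
              by (rule delta_primitive_mono[OF cl aT x(1) _ Yx(1) delta_primitive_subset[OF Y(1)]])
                (use ax x s s\<beta> in \<open>auto intro!: mult_right_mono k_mono \<Phi>_nn u_nn\<close>)
          qed (use ya in auto)
          have V_ge: "\<epsilon> + y x \<le> V x" if x: "x \<in> Ts" "x \<le> s" for x
            using yV[OF x] Z_le[of x] x s\<beta> by (auto simp: V_def)
          have "\<Psi> (V s) \<le> \<Psi> (V a) + (Q s - Q a)"
          proof (rule bihari_comparison[OF cl aT s(1) sb(2) _ _ Q(1), where A = "{0<..}" and w = \<phi> and V = V and \<Psi> = \<Psi>])
            show "delta_primitive Ts a s (\<lambda>x. 1 * (k s x * \<Phi> (u x)) + (-1) * (k ?\<beta> x * \<Phi> (q x * max (\<alpha> x) 1))) V"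
              unfolding V_def
              by (rule delta_primitive_affine[OF Y(1) delta_primitive_subset[OF Z(1)]]) (use s\<beta> in auto)
            show "V x \<in> {0<..}" if "x \<in> Ts" "a \<le> x" "x \<le> s" for x
              using V_ge[of x] y_nn[of x] that sb \<epsilon> by auto
            fix x assume x: "x \<in> Ts" "a \<le> x" "x < s"
            have "k s x * \<Phi> (u x) \<le> k s x * (\<Phi> (q x * max (\<alpha> x) 1) + p x * \<phi> (y x))"
              using x s sb by (intro mult_left_mono \<Phi>u_le k_nn) auto
            also have "\<dots> = k s x * \<Phi> (q x * max (\<alpha> x) 1) + k s x * p x * \<phi> (y x)" by (simp add: algebra_simps)
            \<comment> \<open>Raising the first argument from s to \<rho>(b) makes this term match
              the derivative of Z.\<close>
            also have "k s x * \<Phi> (q x * max (\<alpha> x) 1) \<le> k ?\<beta> x * \<Phi> (q x * max (\<alpha> x) 1)"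
              using x s sb s\<beta> \<beta>T qt[of x] by (intro mult_right_mono k_mono \<Phi>_nn) auto
            also have "k s x * p x * \<phi> (y x) \<le> k s x * p x * \<phi> (V x)"
              using x s sb V_ge[of x] y_nn[of x] \<epsilon>
              by (intro mult_left_mono mult_nonneg_nonneg k_nn p_nn \<phi>_mono) auto
            finally show "1 * (k s x * \<Phi> (u x)) + (-1) * (k ?\<beta> x * \<Phi> (q x * max (\<alpha> x) 1)) \<le> k s x * p x * \<phi> (V x)"
              by simp
          qed (use PP \<phi>_pos in auto)
          moreover have "V a = \<epsilon> + \<zeta>" by (simp add: V_def)
          moreover have "\<Psi> (\<epsilon> + y s) \<le> \<Psi> (V s)"
            using V_ge[OF s(1)] y_nn[OF s(1) sb(1)] \<epsilon> strict_mono_on_leD[OF PP(3)] by auto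
          ultimately show ?thesis using Q(2) by simp
        qed
        \<comment> \<open>P(s) lies between 0 and P(\<rho>(t)), so the hypothesis at \<rho>(t)
          covers s.\<close>
        have range_s: "\<Psi> \<zeta> + P s \<in> \<Psi> ` {0<..}"
        proof (rule between_in_image[OF PP(1) _ range\<Psi>])
          show "\<Psi> \<zeta> \<in> \<Psi> ` {0<..}" using \<zeta>_pos by auto
          have "0 \<le> P s" unfolding P_def
            by (rule delta_integral_nonneg[OF cl aT s(1) sb(2) P_int[OF s(1) \<rho>_ge[OF s]]])
              (use s sb in \<open>auto intro!: mult_nonneg_nonneg k_nn p_nn\<close>)
          then show "\<Psi> \<zeta> \<le> \<Psi> \<zeta> + P s" by simp
          show "\<Psi> \<zeta> + P s \<le> \<Psi> \<zeta> + P ?\<rho>" by (intro add_left_mono P_mono[OF s])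
        qed
        show ?thesis
        \<comment> \<open>\<Psi> is not controlled at 0, but there positivity of the inverse value
          suffices. Otherwise continuity of \<Psi> at \<zeta> > 0 lets \<epsilon> tend to 0.\<close>
        proof (cases "y s = 0")
          case True
          then show ?thesis using inv_into_into[OF range_s] by simp
        next
          case False
          then have y_pos: "0 < y s" using y_nn[OF s(1) sb(1)] by simp
          have "((\<lambda>\<epsilon>. \<Psi> (\<epsilon> + \<zeta>) + P s) \<longlongrightarrow> \<Psi> (0 + \<zeta>) + P s) (at_right 0)"
          proof (intro tendsto_intros)
            have "isCont \<Psi> (0 + \<zeta>)" using PP(1) \<zeta>_pos by (auto simp: continuous_on_eq_continuous_at)
            then show "((\<lambda>\<epsilon>. \<Psi> (\<epsilon> + \<zeta>)) \<longlongrightarrow> \<Psi> (0 + \<zeta>)) (at_right 0)"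
              by (rule isCont_tendsto_compose) (intro tendsto_intros)
          qed
          moreover have "\<forall>\<^sub>F \<epsilon> in at_right 0. \<Psi> (y s) \<le> \<Psi> (\<epsilon> + \<zeta>) + P s"
            unfolding eventually_at_right_field
          proof (intro exI[of _ 1] conjI allI impI)
            fix \<epsilon> :: real assume \<epsilon>: "0 < \<epsilon>"
            have "\<Psi> (y s) \<le> \<Psi> (\<epsilon> + y s)" using strict_mono_on_leD[OF PP(3)] y_pos \<epsilon> by auto
            then show "\<Psi> (y s) \<le> \<Psi> (\<epsilon> + \<zeta>) + P s" using y\<epsilon>[OF \<epsilon>] by simp
          qed simp
          ultimately have "\<Psi> (y s) \<le> \<Psi> (0 + \<zeta>) + P s"
            by (rule tendsto_lowerbound) simp
          then show ?thesis using y_pos by (intro le_inv_into[OF PP(3) _ range_s]) auto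
        qed
      qed
      then show ?thesis using y_nn[OF s(1) sb(1)] by (intro W_mono)
    qed
    \<comment> \<open>The integrands are compared only at s < t, hence at s \<le> \<rho>(t), which
      is why the range hypothesis at \<rho>(t) is enough.\<close>
    have "?fW t \<le> delta_integral Ts a t (\<lambda>s. f s * W (inv_into {0<..} \<Psi> (\<Psi> \<zeta> + P s)))"
      by (rule delta_integral_mono[OF cl aT t at(1) t order.refl fW_int[OF t] R_int0[unfolded P_eq]])
        (use W_le f_nn at in \<open>auto intro!: mult_left_mono\<close>)
    then have "n t \<le> max (\<alpha> t) 1 + delta_integral Ts a t (\<lambda>s. f s * W (inv_into {0<..} \<Psi> (\<Psi> \<zeta> + P s)))"
      by (simp add: n_def)
    then have "q t * n t \<le> q t * (max (\<alpha> t) 1 + delta_integral Ts a t (\<lambda>s. f s * W (inv_into {0<..} \<Psi> (\<Psi> \<zeta> + P s))))"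
      using qt[OF t] by (intro mult_left_mono) auto
    then show "u t \<le> q t * max (\<alpha> t) 1 + q t * delta_integral Ts a t
         (\<lambda>s. f s * W (inv_into {0<..} \<Psi> (\<Psi> \<zeta> + delta_integral Ts a s
               (\<lambda>\<tau>. k s \<tau> * \<Phi> (q \<tau>) * \<Phi> (delta_integral Ts a \<tau> f)))))"
      unfolding P_eq using us[OF t] by (simp add: distrib_left)
  qed
qed

end
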